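(* Let $B$ be a finite Blaschke product and let $S(z)=\exp\left(-\frac{1+z}{1-z}\right)$. Then $S\circ B\in\mathfrak I_c$.
   Context: $\mathbb D$ is the open unit disk. A finite Blaschke product is a function $B(z)=e^{i\theta}\prod_{j=1}^N\frac{a_j-z}{1-\overline{a_j}z}$ with $N\ge 1$, $\theta\in\mathbb R$, $a_j\in\mathbb D$. $S$ is the atomic inner function on $\mathbb D$. $\mathfrak I_c$ denotes the set of one-component inner functions: inner functions $u$ on $\mathbb D$ for which there is $\eta\in\,]0,1[$ such that $\Omega_u(\eta)=\{z\in\mathbb D:|u(z)|<\eta\}$ is connected. *)

theory Defs
  imports "HOL-Analysis.Analysis"
begin

text \<open>
  Functions on the open unit disk \<open>ball 0 1\<close> are total functions on \<^typ>\<open>complex\<close>; all predicates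
  below depend only on the values on \<open>ball 0 1\<close>.
\<close>

definition finite_Blaschke_product :: "(complex \<Rightarrow> complex) \<Rightarrow> bool" where
  "finite_Blaschke_product B \<longleftrightarrow>
     (\<exists>(N::nat) (\<theta>::real) (a :: nat \<Rightarrow> complex).
        N \<ge> 1 \<and> (\<forall>j\<in>{1..N}. a j \<in> ball 0 1) \<and>
        (\<forall>z\<in>ball 0 1. B z = exp (\<i> * of_real \<theta>) * (\<Prod>j=1..N. (a j - z) / (1 - cnj (a j) * z))))"

definition atomic_inner :: "complex \<Rightarrow> complex" where
  "atomic_inner z = exp (- ((1 + z) / (1 - z)))"

text \<open>
  Inner functions: bounded holomorphic functions on the disk whose radial limit
  exists and is unimodular at almost every boundary point \<open>exp (\<i> t)\<close>.
\<close>

definition inner_function :: "(complex \<Rightarrow> complex) \<Rightarrow> bool" where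
  "inner_function u \<longleftrightarrow>
     u holomorphic_on ball 0 1 \<and>
     bounded (u ` ball 0 1) \<and>
     (AE t in lebesgue_on {0..2 * pi}.
        \<exists>l. ((\<lambda>r::real. u (of_real r * exp (\<i> * of_real t))) \<longlongrightarrow> l) (at_left 1) \<and> norm l = 1)"

definition sublevel_set :: "(complex \<Rightarrow> complex) \<Rightarrow> real \<Rightarrow> complex set" where
  "sublevel_set u \<eta> = {z \<in> ball 0 1. norm (u z) < \<eta>}"

definition one_component_inner_functions :: "(complex \<Rightarrow> complex) set" where
  "one_component_inner_functions =
     {u. inner_function u \<and> (\<exists>\<eta>::real. 0 < \<eta> \<and> \<eta> < 1 \<and> connected (sublevel_set u \<eta>))}"

end

theory Submission
  imports Defs "HOL-Complex_Analysis.Conformal_Mappings"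
begin

text \<open>
  The modulus of the atomic inner function \<open>S\<close> is the exponential of minus the Poisson kernel
  with pole at \<open>1\<close>, so its sublevel sets are horodisks at \<open>1\<close>: Euclidean disks
  inside the unit disk \<open>\<D>\<close> tangent to the circle at \<open>1\<close>, which exhaust \<open>\<D>\<close> as the level tends to \<open>1\<close>
  (\<open>sublevel_atomic_inner\<close>). A sublevel set of \<open>S \<circ> B\<close> is therefore the preimage under \<open>B\<close> of a
  horodisk \<open>H\<close>.

  A finite Blaschke product is a proper map of \<open>\<D>\<close>, because it extends continuously to the closed
  disk and is unimodular on the circle. By the open mapping theorem and properness, every connected
  component of the preimage of \<open>H\<close> is mapped onto all of \<open>H\<close>; in particular it contains a zero of
  \<open>B\<close> once \<open>0 \<in> H\<close>. But the zeros of \<open>B\<close> all lie in one disk \<open>cball 0 r\<close> with \<open>r < 1\<close>, whose image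
  under \<open>B\<close> is a compact subset of \<open>\<D>\<close> and hence lies in \<open>H\<close> when the level is close enough to
  \<open>1\<close>. So all components meet a connected subset of the preimage, and there is only one
  (\<open>connected_preimage_of_proper_disk_map\<close>).

  That \<open>S \<circ> B\<close> is inner is elementary: its radial limit is unimodular at each point of the circle
  where \<open>B\<close> differs from \<open>1\<close>, and \<open>B = 1\<close> amounts to a nontrivial polynomial equation, so only
  finitely many points are excluded.
\<close>

section \<open>Proper holomorphic self-maps of the disk\<close>

text \<open>
  The image of a component of the preimage of \<open>V\<close> is open in \<open>V\<close> by the open mapping theorem. It is
  also closed in \<open>V\<close>: a limit of points of the component cannot lie on the circle if its image lies
  in \<open>V\<close>, so it lies in the preimage, in which components are closed. As \<open>V\<close> is
  connected, the image is all of \<open>V\<close>.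
\<close>
lemma component_of_preimage_maps_onto:
  fixes f :: "complex \<Rightarrow> complex"
  assumes hol: "f holomorphic_on ball 0 1" and cont: "continuous_on (cball 0 1) f"
    and unimod: "\<And>z. norm z = 1 \<Longrightarrow> norm (f z) = 1"
    and nonconst: "\<not> f constant_on ball 0 1"
    and V: "open V" "connected V" "V \<subseteq> ball 0 1"
    and x: "norm x < 1" "f x \<in> V"
  shows "f ` connected_component_set {z \<in> ball 0 1. f z \<in> V} x = V"
proof -
  define U where "U = {z \<in> ball 0 1. f z \<in> V}"
  define C where "C = connected_component_set U x"
  have "open (ball 0 1 \<inter> f -` V)"
    using hol holomorphic_on_imp_continuous_on V(1) continuous_open_preimage open_ball by blast
  then have "open U"
    by (simp add: U_def vimage_def Int_def)
  then have "open C"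
    unfolding C_def by (rule open_connected_component)
  have CU: "C \<subseteq> U"
    unfolding C_def by (rule connected_component_subset)
  then have Cball: "C \<subseteq> ball 0 1" and fCV: "f ` C \<subseteq> V"
    by (auto simp: U_def)
  have "open (f ` C)"
    by (rule open_mapping_thm[OF hol _ _ \<open>open C\<close> Cball nonconst]) auto
  then have op: "openin (top_of_set V) (f ` C)"
    using fCV by (simp add: open_subset)
  have clball: "closure C \<subseteq> cball 0 1"
    using Cball by (metis ball_subset_cball closed_cball closure_minimal order_trans)
  have "compact (f ` closure C)"
  proof (rule compact_continuous_image)
    show "continuous_on (closure C) f"
      using cont clball continuous_on_subset by blast
    show "compact (closure C)"
      using clball by (simp add: bounded_subset[OF bounded_cball] compact_eq_bounded_closed)
  qed
  have "f ` C = V \<inter> f ` closure C"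
  proof
    show "f ` C \<subseteq> V \<inter> f ` closure C"
      using fCV closure_subset by blast
    show "V \<inter> f ` closure C \<subseteq> f ` C"
    proof
      fix w assume "w \<in> V \<inter> f ` closure C"
      then obtain z where z: "z \<in> closure C" "f z = w" "w \<in> V" by blast
      have "norm (f z) < 1"
        using z V(3) by auto
      then have "norm z \<noteq> 1"
        using unimod by fastforce
      moreover have "norm z \<le> 1"
        using z clball by auto
      ultimately have "z \<in> U"
        using z by (simp add: U_def)
      moreover have "closedin (top_of_set U) C"
        unfolding C_def by (rule closedin_connected_component)
      then obtain T where "closed T" "C = U \<inter> T"
        by (auto simp: closedin_closed)
      moreover from this have "closure C \<subseteq> T"
        by (simp add: closure_minimal)
      ultimately have "z \<in> C"
        using z(1) by blast
      then show "w \<in> f ` C"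
        using z by blast
    qed
  qed
  moreover have "closedin (top_of_set V) (V \<inter> f ` closure C)"
    by (intro closedin_closed_Int compact_imp_closed) fact
  ultimately have cl: "closedin (top_of_set V) (f ` C)"
    by simp
  have "x \<in> C"
    using x by (simp add: C_def U_def)
  then have "f ` C = V"
    using V(2) op cl unfolding connected_clopen by blast
  then show ?thesis
    by (simp add: C_def U_def)
qed

text \<open>
  Every component of the preimage contains a point over \<open>w\<close>, and the connected set \<open>K\<close> joins all
  these points inside the preimage.
\<close>
lemma connected_preimage_of_proper_disk_map:
  fixes f :: "complex \<Rightarrow> complex"
  assumes hol: "f holomorphic_on ball 0 1" and cont: "continuous_on (cball 0 1) f"
    and unimod: "\<And>z. norm z = 1 \<Longrightarrow> norm (f z) = 1"
    and nonconst: "\<not> f constant_on ball 0 1"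
    and V: "open V" "connected V" "V \<subseteq> ball 0 1"
    and w: "w \<in> V"
    and K: "connected K" "K \<subseteq> ball 0 1" "f ` K \<subseteq> V"
    and fibre: "\<And>z. norm z < 1 \<Longrightarrow> f z = w \<Longrightarrow> z \<in> K"
  shows "connected {z \<in> ball 0 1. f z \<in> V}"
proof -
  let ?U = "{z \<in> ball 0 1. f z \<in> V}"
  have to_K: "\<exists>k\<in>K. connected_component ?U x k" if "x \<in> ?U" for x
  proof -
    have "w \<in> f ` connected_component_set ?U x"
      using component_of_preimage_maps_onto[OF hol cont unimod nonconst V, of x] that w by simp
    then obtain k where k: "connected_component ?U x k" "f k = w" by blast
    then have "k \<in> ?U"
      using connected_component_in by blast
    then have "k \<in> K"
      using fibre k by simp
    then show ?thesis
      using k by blast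
  qed
  have in_K: "connected_component ?U k l" if "k \<in> K" "l \<in> K" for k l
    unfolding connected_component_def using K that by (intro exI[of _ K]) auto
  show ?thesis
    unfolding connected_iff_connected_component
  proof (intro ballI)
    fix x y assume "x \<in> ?U" "y \<in> ?U"
    then obtain k l where "k \<in> K" "l \<in> K" "connected_component ?U x k" "connected_component ?U y l"
      using to_K by meson
    then show "connected_component ?U x y"
      using in_K connected_component_trans connected_component_sym by meson
  qed
qed

section \<open>The atomic inner function\<close>

text \<open>The exponent is minus the Poisson kernel of the disk with pole at \<open>1\<close>.\<close>
lemma norm_atomic_inner:
  "norm (atomic_inner w) = exp (- ((1 - (norm w)\<^sup>2) / (norm (1 - w))\<^sup>2))"
proof -
  have "Re ((1 + w) / (1 - w)) = (1 - (norm w)\<^sup>2) / (norm (1 - w))\<^sup>2"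
    by (simp add: Re_divide cmod_power2) (simp add: algebra_simps power2_eq_square)
  then show ?thesis
    by (simp add: atomic_inner_def)
qed

lemma norm_atomic_inner_less_1:
  assumes "norm w < 1"
  shows "norm (atomic_inner w) < 1"
proof -
  have "w \<noteq> 1"
    using assms by auto
  moreover have "(norm w)\<^sup>2 < 1"
    using assms by (simp add: power_less_one_iff abs_square_less_1)
  ultimately show ?thesis
    by (simp add: norm_atomic_inner)
qed

lemma norm_atomic_inner_eq_1:
  assumes "norm w = 1"
  shows "norm (atomic_inner w) = 1"
  using assms by (simp add: norm_atomic_inner)

lemma holomorphic_atomic_inner: "atomic_inner holomorphic_on (- {1})"
  unfolding atomic_inner_def by (intro holomorphic_intros) auto

text \<open>
  The inequality between the Poisson kernel and \<open>L = - ln \<eta>\<close> that defines the sublevel set becomes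
  the equation of a disk after clearing denominators and completing the square.
\<close>
lemma sublevel_atomic_inner:
  assumes "0 < \<eta>" "\<eta> < 1"
  defines "L \<equiv> - ln \<eta>"
  shows "sublevel_set atomic_inner \<eta> = ball (of_real (L / (1 + L))) (1 / (1 + L))"
proof (rule set_eqI)
  fix w :: complex
  have L: "L > 0"
    using assms by simp
  define D where "D = (norm (1 - w))\<^sup>2"
  have D: "D = 1 - 2 * Re w + (norm w)\<^sup>2"
    unfolding D_def cmod_power2 by (simp add: power2_eq_square algebra_simps)
  have "w \<in> ball (of_real (L / (1 + L))) (1 / (1 + L)) \<longleftrightarrow>
      (norm (w - of_real (L / (1 + L))))\<^sup>2 < (1 / (1 + L))\<^sup>2"
    using L by (auto simp: dist_norm norm_minus_commute simp del: power_divide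
        intro: power_strict_mono dest: power2_less_imp_less)
  also have "(norm (w - of_real (L / (1 + L))))\<^sup>2
      = (norm w)\<^sup>2 - 2 * (L / (1 + L)) * Re w + (L / (1 + L))\<^sup>2"
    unfolding cmod_power2 by (simp add: power2_eq_square algebra_simps)
  also have "(norm w)\<^sup>2 - 2 * (L / (1 + L)) * Re w + (L / (1 + L))\<^sup>2 < (1 / (1 + L))\<^sup>2 \<longleftrightarrow>
      L * D < 1 - (norm w)\<^sup>2"
  proof -
    have "(1 / (1 + L))\<^sup>2 - ((norm w)\<^sup>2 - 2 * (L / (1 + L)) * Re w + (L / (1 + L))\<^sup>2)
        = (1 - (norm w)\<^sup>2 - L * D) / (1 + L)"
      using L unfolding D by (simp add: divide_simps) (simp add: algebra_simps power2_eq_square)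
    then show ?thesis
      using L by (smt (verit) zero_less_divide_iff)
  qed
  also have "\<dots> \<longleftrightarrow> w \<in> sublevel_set atomic_inner \<eta>"
  proof (cases "norm w < 1")
    case True
    then have "w \<noteq> 1" by auto
    then have "D > 0" by (simp add: D_def)
    have "norm (atomic_inner w) < \<eta> \<longleftrightarrow> - ((1 - (norm w)\<^sup>2) / D) < ln \<eta>"
      using assms(1) by (metis D_def norm_atomic_inner exp_less_cancel_iff exp_ln)
    also have "\<dots> \<longleftrightarrow> L * D < 1 - (norm w)\<^sup>2"
      using \<open>D > 0\<close> by (auto simp: L_def field_simps)
    finally show ?thesis
      using True by (simp add: sublevel_set_def)
  next
    case False
    then have "1 - (norm w)\<^sup>2 \<le> 0"
      by (simp add: one_le_power)
    moreover have "L * D \<ge> 0"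
      using L by (simp add: D_def)
    ultimately have "\<not> L * D < 1 - (norm w)\<^sup>2"
      by linarith
    then show ?thesis
      using False by (simp add: sublevel_set_def)
  qed
  finally show "w \<in> sublevel_set atomic_inner \<eta> \<longleftrightarrow>
      w \<in> ball (of_real (L / (1 + L))) (1 / (1 + L))" by simp
qed

section \<open>Finite Blaschke products\<close>

lemma blaschke_denominator_nonzero:
  fixes a z :: complex
  assumes "norm a < 1" "norm z \<le> 1"
  shows "1 - cnj a * z \<noteq> 0"
proof
  assume "1 - cnj a * z = 0"
  then have "norm a * norm z = 1"
    by (metis complex_mod_cnj eq_iff_diff_eq_0 norm_mult norm_one)
  moreover have "norm a * norm z \<le> norm a * 1"
    using assms by (intro mult_left_mono) auto
  ultimately show False
    using assms by simp
qed

text \<open>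
  The sign of the right-hand side tells whether the factor \<open>(a - z) / (1 - cnj a * z)\<close> has modulus
  below or equal to \<open>1\<close>.
\<close>
lemma blaschke_factor_identity:
  fixes a z :: complex
  shows "(norm (1 - cnj a * z))\<^sup>2 - (norm (a - z))\<^sup>2 = (1 - (norm a)\<^sup>2) * (1 - (norm z)\<^sup>2)"
  unfolding cmod_power2 by (simp add: power2_eq_square algebra_simps)

lemma norm_blaschke_factor_less_1:
  assumes "norm a < 1" "norm z < 1"
  shows "norm ((a - z) / (1 - cnj a * z)) < 1"
proof -
  have "(1 - (norm a)\<^sup>2) * (1 - (norm z)\<^sup>2) > 0"
    using assms by (simp add: power_less_one_iff abs_square_less_1)
  then have "(norm (a - z))\<^sup>2 < (norm (1 - cnj a * z))\<^sup>2"
    using blaschke_factor_identity[of a z] by linarith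
  then have "norm (a - z) < norm (1 - cnj a * z)"
    by (simp add: power2_less_imp_less)
  then show ?thesis
    using blaschke_denominator_nonzero[of a z] assms by (simp add: norm_divide)
qed

lemma norm_blaschke_factor_eq_1:
  assumes "norm a < 1" "norm z = 1"
  shows "norm ((a - z) / (1 - cnj a * z)) = 1"
proof -
  have "(norm (a - z))\<^sup>2 = (norm (1 - cnj a * z))\<^sup>2"
    using blaschke_factor_identity[of a z] assms by simp
  then show ?thesis
    using blaschke_denominator_nonzero[of a z] assms by (simp add: norm_divide)
qed

definition blaschke_product :: "nat \<Rightarrow> real \<Rightarrow> (nat \<Rightarrow> complex) \<Rightarrow> complex \<Rightarrow> complex" where
  "blaschke_product N \<theta> a z =
     exp (\<i> * of_real \<theta>) * (\<Prod>j=1..N. (a j - z) / (1 - cnj (a j) * z))"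

context
  fixes N :: nat and \<theta> :: real and a :: "nat \<Rightarrow> complex"
  assumes N: "N \<ge> 1" and zeros_in_disk: "\<And>j. j \<in> {1..N} \<Longrightarrow> norm (a j) < 1"
begin

lemma blaschke_product_isCont:
  assumes "norm z \<le> 1"
  shows "isCont (blaschke_product N \<theta> a) z"
  unfolding blaschke_product_def
  using blaschke_denominator_nonzero[OF zeros_in_disk assms]
  by (intro continuous_intros) auto

lemma blaschke_product_holomorphic: "blaschke_product N \<theta> a holomorphic_on ball 0 1"
  unfolding blaschke_product_def
  using blaschke_denominator_nonzero[OF zeros_in_disk]
  by (intro holomorphic_intros) auto

lemma blaschke_product_norm_eq_1:
  assumes "norm z = 1"
  shows "norm (blaschke_product N \<theta> a z) = 1"
  unfolding blaschke_product_def
  using norm_blaschke_factor_eq_1[OF zeros_in_disk assms]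
  by (simp add: norm_mult prod_norm[symmetric])

lemma blaschke_product_norm_less_1:
  assumes "norm z < 1"
  shows "norm (blaschke_product N \<theta> a z) < 1"
proof -
  let ?g = "\<lambda>j. norm ((a j - z) / (1 - cnj (a j) * z))"
  have g: "?g j < 1" if "j \<in> {1..N}" for j
    using norm_blaschke_factor_less_1[OF zeros_in_disk[OF that] assms] .
  have "norm (blaschke_product N \<theta> a z) = prod ?g {1..N}"
    by (simp add: blaschke_product_def norm_mult prod_norm)
  (* One factor is kept apart: it makes the bound strict, the others are only needed to be at most 1. *)
  also have "\<dots> = ?g 1 * prod ?g ({1..N} - {1})"
    using N by (intro prod.remove) auto
  also have "\<dots> \<le> ?g 1 * 1"
    using g by (intro mult_left_mono prod_le_1) (auto intro: less_imp_le)
  also have "\<dots> < 1"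
    using g N by simp
  finally show ?thesis .
qed

lemma blaschke_product_eq_0_iff:
  assumes "norm z < 1"
  shows "blaschke_product N \<theta> a z = 0 \<longleftrightarrow> z \<in> a ` {1..N}"
  using blaschke_denominator_nonzero[OF zeros_in_disk, of _ z] assms
  by (auto simp: blaschke_product_def)

lemma blaschke_product_nonconstant: "\<not> blaschke_product N \<theta> a constant_on ball 0 1"
proof
  assume "blaschke_product N \<theta> a constant_on ball 0 1"
  moreover have "a 1 \<in> ball 0 1" and "blaschke_product N \<theta> a (a 1) = 0"
    using blaschke_product_eq_0_iff[of "a 1"] zeros_in_disk[of 1] N by auto
  ultimately have "blaschke_product N \<theta> a z = 0" if "z \<in> ball 0 1" for z
    using that by (metis constant_on_def)
  moreover have "continuous_on (closure (ball 0 1)) (blaschke_product N \<theta> a)"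
    using blaschke_product_isCont by (auto intro: continuous_at_imp_continuous_on)
  ultimately have "blaschke_product N \<theta> a 1 = 0"
    using continuous_constant_on_closure[of "ball 0 1" "blaschke_product N \<theta> a" 0 1] by auto
  then show False
    using blaschke_product_norm_eq_1[of 1] by simp
qed

text \<open>
  Clearing denominators turns the equation into a polynomial one. The polynomial is not zero, since
  at the zero \<open>a 1\<close> of \<open>B\<close> its value is minus a product of nonzero denominators.
\<close>
lemma finite_blaschke_product_eq_1: "finite {z. norm z = 1 \<and> blaschke_product N \<theta> a z = 1}"
proof -
  define P where "P = smult (exp (\<i> * of_real \<theta>)) (\<Prod>j=1..N. [:a j, -1:]) - (\<Prod>j=1..N. [:1, - cnj (a j):])"
  have P: "poly P z = exp (\<i> * of_real \<theta>) * (\<Prod>j=1..N. a j - z) - (\<Prod>j=1..N. 1 - cnj (a j) * z)" for z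
    by (simp add: P_def poly_prod mult.commute)
  have "(\<Prod>j=1..N. a j - a 1) = 0"
    using N by (intro prod_zero) auto
  moreover have "(\<Prod>j=1..N. 1 - cnj (a j) * a 1) \<noteq> 0"
    using blaschke_denominator_nonzero[OF zeros_in_disk, of _ "a 1"] zeros_in_disk[of 1] N
    by (auto simp: less_imp_le)
  ultimately have "poly P (a 1) \<noteq> 0"
    by (simp only: P) simp
  then have "P \<noteq> 0" by auto
  have "poly P z = 0" if "norm z = 1" "blaschke_product N \<theta> a z = 1" for z
  proof -
    have "(\<Prod>j=1..N. 1 - cnj (a j) * z) \<noteq> 0"
      using blaschke_denominator_nonzero[OF zeros_in_disk, of _ z] that by auto
    then show ?thesis
      using that by (simp add: P blaschke_product_def prod_dividef field_simps)
  qed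
  then have "{z. norm z = 1 \<and> blaschke_product N \<theta> a z = 1} \<subseteq> {z. poly P z = 0}" by blast
  then show ?thesis
    using poly_roots_finite[OF \<open>P \<noteq> 0\<close>] finite_subset by blast
qed

section \<open>Composing the atomic inner function with a finite Blaschke product\<close>

lemma AE_blaschke_product_cis_neq_1:
  "AE t in lebesgue_on {0..2 * pi}. blaschke_product N \<theta> a (exp (\<i> * of_real t)) \<noteq> 1"
proof -
  let ?Z = "{z. norm z = 1 \<and> blaschke_product N \<theta> a z = 1}"
  have "inj_on cis {0..<2 * pi}"
    by (rule inj_on_inverseI[where g = Arg2pi]) (auto intro!: Arg2pi_unique[of 1] simp: cis_conv_exp)
  (* The endpoint is excluded from the injectivity interval and enters the null set separately. *)
  then have "finite (insert (2 * pi) (cis -` ?Z \<inter> {0..<2 * pi}))"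
    by (intro finite.insertI finite_vimage_IntI finite_blaschke_product_eq_1)
  then have null: "insert (2 * pi) (cis -` ?Z \<inter> {0..<2 * pi}) \<in> null_sets lebesgue"
    by (simp only: negligible_finite flip: negligible_iff_null_sets)
  have "AE t in lebesgue. t \<in> {0..2 * pi} \<longrightarrow> blaschke_product N \<theta> a (exp (\<i> * of_real t)) \<noteq> 1"
  proof (rule AE_I'[OF null], rule subsetI)
    fix t assume "t \<in> {t \<in> space lebesgue.
      \<not> (t \<in> {0..2 * pi} \<longrightarrow> blaschke_product N \<theta> a (exp (\<i> * of_real t)) \<noteq> 1)}"
    then show "t \<in> insert (2 * pi) (cis -` ?Z \<inter> {0..<2 * pi})"
      by (auto simp: cis_conv_exp)
  qed
  then show ?thesis
    by (subst AE_restrict_space_iff) auto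
qed

lemma inner_function_atomic_inner_blaschke_product:
  "inner_function (atomic_inner \<circ> blaschke_product N \<theta> a)"
  unfolding inner_function_def
proof (intro conjI)
  have maps: "blaschke_product N \<theta> a ` ball 0 1 \<subseteq> ball 0 1"
    using blaschke_product_norm_less_1 by auto
  show "atomic_inner \<circ> blaschke_product N \<theta> a holomorphic_on ball 0 1"
    using maps
    by (intro holomorphic_on_compose_gen[OF blaschke_product_holomorphic holomorphic_atomic_inner]) auto
  show "bounded ((atomic_inner \<circ> blaschke_product N \<theta> a) ` ball 0 1)"
    unfolding bounded_iff
    by (rule exI[of _ 1]) (auto intro!: less_imp_le norm_atomic_inner_less_1 blaschke_product_norm_less_1)
  show "AE t in lebesgue_on {0..2 * pi}. \<exists>l.
      ((\<lambda>r::real. (atomic_inner \<circ> blaschke_product N \<theta> a) (of_real r * exp (\<i> * of_real t)))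
        \<longlongrightarrow> l) (at_left 1) \<and> norm l = 1"
    using AE_blaschke_product_cis_neq_1
  proof eventually_elim
    fix t :: real
    let ?e = "exp (\<i> * of_real t)"
    assume neq: "blaschke_product N \<theta> a ?e \<noteq> 1"
    have "isCont atomic_inner (blaschke_product N \<theta> a ?e)"
      using neq unfolding atomic_inner_def by (intro continuous_intros) auto
    then have "isCont (atomic_inner \<circ> blaschke_product N \<theta> a) ?e"
      by (intro continuous_at_compose blaschke_product_isCont) simp_all
    moreover have "((\<lambda>r::real. of_real r * ?e) \<longlongrightarrow> ?e) (at_left 1)"
      by (rule tendsto_eq_intros refl)+ simp
    ultimately have "((\<lambda>r::real. (atomic_inner \<circ> blaschke_product N \<theta> a) (of_real r * ?e))
        \<longlongrightarrow> (atomic_inner \<circ> blaschke_product N \<theta> a) ?e) (at_left 1)"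
      by (rule isCont_tendsto_compose)
    moreover have "norm ((atomic_inner \<circ> blaschke_product N \<theta> a) ?e) = 1"
      by (simp add: norm_atomic_inner_eq_1 blaschke_product_norm_eq_1)
    ultimately show "\<exists>l. ((\<lambda>r::real. (atomic_inner \<circ> blaschke_product N \<theta> a) (of_real r * ?e))
        \<longlongrightarrow> l) (at_left 1) \<and> norm l = 1" by blast
  qed
qed

text \<open>
  The level is chosen above the maximum of \<open>S \<circ> B\<close> in modulus over a closed disk that contains all
  zeros of \<open>B\<close>.
\<close>
lemma connected_sublevel_atomic_inner_blaschke_product:
  "\<exists>\<eta>. 0 < \<eta> \<and> \<eta> < 1 \<and> connected (sublevel_set (atomic_inner \<circ> blaschke_product N \<theta> a) \<eta>)"
proof -
  let ?B = "blaschke_product N \<theta> a"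
  define r where "r = Max ((norm \<circ> a) ` {1..N})"
  have r: "r < 1"
    unfolding r_def using N zeros_in_disk by (subst Max_less_iff) auto
  have zeros: "a j \<in> cball 0 r" if "j \<in> {1..N}" for j
    using that by (auto simp: r_def intro!: Max_ge)
  have sub: "cball 0 r \<subseteq> ball (0::complex) 1"
    using r by auto
  have "isCont (\<lambda>z. norm ((atomic_inner \<circ> ?B) z)) z" if "norm z < 1" for z
  proof -
    have "?B z \<noteq> 1"
      using blaschke_product_norm_less_1[OF that] by auto
    then have "isCont atomic_inner (?B z)"
      unfolding atomic_inner_def by (intro continuous_intros) auto
    then show ?thesis
      using that by (intro continuous_norm continuous_at_compose blaschke_product_isCont) auto
  qed
  then have "continuous_on (cball 0 r) (\<lambda>z. norm ((atomic_inner \<circ> ?B) z))"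
    using sub by (intro continuous_at_imp_continuous_on) auto
  moreover have a1: "a 1 \<in> cball 0 r"
    using zeros N by simp
  ultimately have "\<exists>z0\<in>cball 0 r. \<forall>z\<in>cball 0 r.
      norm ((atomic_inner \<circ> ?B) z) \<le> norm ((atomic_inner \<circ> ?B) z0)"
    by (intro continuous_attains_sup compact_cball) blast+
  then obtain z0 where z0: "z0 \<in> cball 0 r"
    and max: "\<And>z. z \<in> cball 0 r \<Longrightarrow> norm (atomic_inner (?B z)) \<le> norm (atomic_inner (?B z0))"
    unfolding o_apply by blast
  have "norm (atomic_inner (?B z0)) < 1"
    using z0 sub by (intro norm_atomic_inner_less_1 blaschke_product_norm_less_1) auto
  then obtain \<eta> where \<eta>: "norm (atomic_inner (?B z0)) < \<eta>" "\<eta> < 1"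
    using dense by blast
  then have \<eta>0: "0 < \<eta>"
    using norm_ge_zero le_less_trans by blast
  let ?H = "sublevel_set atomic_inner \<eta>"
  have "open ?H" "connected ?H" "?H \<subseteq> ball 0 1"
    using sublevel_atomic_inner[OF \<eta>0 \<eta>(2)] by (auto simp: sublevel_set_def)
  moreover have im: "?B ` cball 0 r \<subseteq> ?H"
  proof (rule image_subsetI)
    fix z :: complex assume z: "z \<in> cball 0 r"
    then have "norm (?B z) < 1"
      using sub by (intro blaschke_product_norm_less_1) auto
    moreover have "norm (atomic_inner (?B z)) < \<eta>"
      using max[OF z] \<eta>(1) by (rule le_less_trans)
    ultimately show "?B z \<in> ?H"
      by (simp add: sublevel_set_def)
  qed
  moreover have "0 \<in> ?H"
  proof -
    have "?B (a 1) = 0"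
      using blaschke_product_eq_0_iff[of "a 1"] zeros_in_disk[of 1] N by auto
    then show ?thesis
      using im imageI[OF a1, of ?B] by auto
  qed
  moreover have "z \<in> cball 0 r" if "norm z < 1" "?B z = 0" for z
    using that blaschke_product_eq_0_iff zeros by blast
  moreover have "continuous_on (cball 0 1) ?B"
    using blaschke_product_isCont by (auto intro: continuous_at_imp_continuous_on)
  ultimately have "connected {z \<in> ball 0 1. ?B z \<in> ?H}"
    by (intro connected_preimage_of_proper_disk_map[where w = 0 and K = "cball 0 r"]
        blaschke_product_holomorphic blaschke_product_norm_eq_1 blaschke_product_nonconstant
        connected_cball sub)
  also have "{z \<in> ball 0 1. ?B z \<in> ?H} = sublevel_set (atomic_inner \<circ> ?B) \<eta>"
    using blaschke_product_norm_less_1 by (auto simp: sublevel_set_def)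
  finally show ?thesis
    using \<eta>0 \<eta>(2) by blast
qed

end

text \<open>Membership only depends on the values in the disk, the only place where \<open>B\<close> is prescribed.\<close>
lemma one_component_inner_functions_cong:
  assumes eq: "\<And>z. z \<in> ball 0 1 \<Longrightarrow> u z = v z" and u: "u \<in> one_component_inner_functions"
  shows "v \<in> one_component_inner_functions"
proof -
  have sub: "sublevel_set v \<eta> = sublevel_set u \<eta>" for \<eta>
    using eq by (auto simp: sublevel_set_def)
  have "inner_function u"
    using u by (simp add: one_component_inner_functions_def)
  moreover have "v holomorphic_on ball 0 1 \<longleftrightarrow> u holomorphic_on ball 0 1"
    using eq by (intro holomorphic_cong) auto
  moreover have "v ` ball 0 1 = u ` ball 0 1"
    using eq by (intro image_cong) auto
  moreover have "((\<lambda>r::real. v (of_real r * exp (\<i> * of_real t))) \<longlongrightarrow> l) (at_left 1) \<longleftrightarrow>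
      ((\<lambda>r::real. u (of_real r * exp (\<i> * of_real t))) \<longlongrightarrow> l) (at_left 1)" for t l
  proof (rule tendsto_cong)
    have "\<forall>\<^sub>F r in at_left (1::real). 0 < r \<and> r < 1"
      using eventually_at_left_real[of 0 1] by (auto elim: eventually_mono)
    then show "\<forall>\<^sub>F r in at_left (1::real).
        v (of_real r * exp (\<i> * of_real t)) = u (of_real r * exp (\<i> * of_real t))"
      by eventually_elim (simp add: eq norm_mult)
  qed
  ultimately have "inner_function v"
    by (simp add: inner_function_def)
  then show ?thesis
    using u sub by (simp add: one_component_inner_functions_def)
qed

theorem proposition2p13:
  fixes B :: "complex \<Rightarrow> complex"
  assumes "finite_Blaschke_product B"
  shows "atomic_inner \<circ> B \<in> one_component_inner_functions"
proof -
  obtain N :: nat and \<theta> :: real and a :: "nat \<Rightarrow> complex"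
    where N: "N \<ge> 1" and a_ball: "\<forall>j\<in>{1..N}. a j \<in> ball 0 1"
      and B: "\<forall>z\<in>ball 0 1. B z = blaschke_product N \<theta> a z"
    using assms unfolding finite_Blaschke_product_def blaschke_product_def by blast
  have a: "norm (a j) < 1" if "j \<in> {1..N}" for j
    using a_ball that by simp
  have "atomic_inner \<circ> blaschke_product N \<theta> a \<in> one_component_inner_functions"
    unfolding one_component_inner_functions_def
    using inner_function_atomic_inner_blaschke_product[where a = a, OF N a]
      connected_sublevel_atomic_inner_blaschke_product[where a = a, OF N a] by blast
  then show ?thesis
    by (rule one_component_inner_functions_cong[rotated]) (simp add: B)
qed

end
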